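(* Let $G,H$ be finite simple graphs, $\tau$ a linear ordering of $V(G\Box H)$, and $\mathcal{C}$ a proper vertex coloring of $G\Box H$ using colors $1,\ldots,k$. Let $S\subseteq V(G\Box H)$ be any subset that intersects every $(\mathcal{C},\tau)$-descent. Then $S$, with the coloring inherited from $\mathcal{C}$, is a $k$-greedy defining set of $(G\Box H,\tau,\mathcal{C})$.
   Context: $G\Box H$ is the Cartesian product: vertex set $V(G)\times V(H)$, with $(u,v)\sim(u',v')$ iff either $u=u'$ and $vv'\in E(H)$, or $uu'\in E(G)$ and $v=v'$. Descent: for colors $1\le x<y\le k$ and a vertex $v$ with $\mathcal{C}(v)=y$, let $N$ be the set of neighbors of $v$ of color $x$; $\{v\}\cup N$ is a $(\mathcal{C},\tau)$-descent if every $u\in N$ has $\tau(u)>\tau(v)$ (if $N=\emptyset$, $\{v\}$ is a descent). First-Fit coloring of $(G\Box H,\tau)$ subject to a pre-coloring $\mathcal{C}(S)$ of $S$: the vertices of $S$ keep their fixed colors, and the vertices not in $S$ are scanned in the order $\tau$, each receiving the smallest positive integer not used on its already colored neighbors (vertices of $S$ count as colored from the start). $S$ is a $k$-greedy defining set ($k$-GDS) of $(G\Box H,\tau,\mathcal{C})$ if the First-Fit coloring of $(G\Box H,\tau)$ subject to the restriction $\mathcal{C}(S)$ equals $\mathcal{C}$. *)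

theory Defs
  imports "Graph_Theory.Pair_Digraph"
begin

(* Finite simple graphs are the symmetric loop-free finite pair digraphs ("pair_graph"):
   an undirected edge uv is the pair of arcs (u,v), (v,u). *)

definition cart_prod ::
    "'a pair_pre_digraph \<Rightarrow> 'b pair_pre_digraph \<Rightarrow> ('a \<times> 'b) pair_pre_digraph" (infixl "\<box>" 70)
  where
  "G \<box> H = \<lparr> pverts = pverts G \<times> pverts H,
     parcs = {((u, v), (u', v')) | u v u' v'.
       u = u' \<and> u \<in> pverts G \<and> (v, v') \<in> parcs H \<or>
       (u, u') \<in> parcs G \<and> v = v' \<and> v \<in> pverts H} \<rparr>"

lemma pair_graph_cart_prod:
  assumes "pair_graph G" and "pair_graph H"
  shows "pair_graph (G \<box> H)"
proof -
  interpret G: pair_graph G by fact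
  interpret H: pair_graph H by fact
  have wf: "parcs (G \<box> H) \<subseteq> pverts (G \<box> H) \<times> pverts (G \<box> H)"
    by (auto simp: cart_prod_def dest: G.in_arcsD1 G.in_arcsD2 H.in_arcsD1 H.in_arcsD2)
  have fin: "finite (pverts (G \<box> H))"
    by (simp add: cart_prod_def)
  have "sym (parcs (G \<box> H))"
    using G.pair_sym_arcs H.pair_sym_arcs
    by (auto simp: cart_prod_def symmetric_def sym_def)
  then show ?thesis
    using wf fin finite_subset[OF wf]
    by unfold_locales
      (auto simp: symmetric_def cart_prod_def dest: G.no_loops' H.no_loops'
        G.in_arcsD1 G.in_arcsD2 H.in_arcsD1 H.in_arcsD2)
qed

(* A linear ordering is given by the position tau(v) of each vertex v. *)
definition vertex_ordering :: "'v pair_pre_digraph \<Rightarrow> ('v \<Rightarrow> nat) \<Rightarrow> bool" where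
  "vertex_ordering G \<tau> \<longleftrightarrow> bij_betw \<tau> (pverts G) {1..card (pverts G)}"

definition proper_coloring :: "'v pair_pre_digraph \<Rightarrow> nat \<Rightarrow> ('v \<Rightarrow> nat) \<Rightarrow> bool" where
  "proper_coloring G k C \<longleftrightarrow>
     (\<forall>v \<in> pverts G. C v \<in> {1..k}) \<and> (\<forall>(u, v) \<in> parcs G. C u \<noteq> C v)"

definition color_nbrs :: "'v pair_pre_digraph \<Rightarrow> ('v \<Rightarrow> nat) \<Rightarrow> 'v \<Rightarrow> nat \<Rightarrow> 'v set" where
  "color_nbrs G C v x = {u \<in> pverts G. (v, u) \<in> parcs G \<and> C u = x}"

definition is_descent ::
    "'v pair_pre_digraph \<Rightarrow> nat \<Rightarrow> ('v \<Rightarrow> nat) \<Rightarrow> ('v \<Rightarrow> nat) \<Rightarrow> 'v set \<Rightarrow> bool" where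
  "is_descent G k C \<tau> D \<longleftrightarrow>
     (\<exists>x y. \<exists>v \<in> pverts G. 1 \<le> x \<and> x < y \<and> y \<le> k \<and> C v = y \<and>
        D = {v} \<union> color_nbrs G C v x \<and> (\<forall>u \<in> color_nbrs G C v x. \<tau> u > \<tau> v))"

(* Partial colorings are maps; None means "not yet colored". *)
definition first_fit_step ::
    "'v pair_pre_digraph \<Rightarrow> 'v \<Rightarrow> ('v \<rightharpoonup> nat) \<Rightarrow> ('v \<rightharpoonup> nat)" where
  "first_fit_step G v c =
     c(v \<mapsto> (LEAST i. i \<ge> 1 \<and> (\<forall>u \<in> pverts G. (v, u) \<in> parcs G \<longrightarrow> c u \<noteq> Some i)))"

(* The pre-colored set is the domain of the pre-coloring p. *)
definition first_fit ::
    "'v pair_pre_digraph \<Rightarrow> ('v \<Rightarrow> nat) \<Rightarrow> ('v \<rightharpoonup> nat) \<Rightarrow> ('v \<rightharpoonup> nat)" where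
  "first_fit G \<tau> p = fold (first_fit_step G) (sorted_key_list_of_set \<tau> (pverts G - dom p)) p"

definition is_GDS ::
    "nat \<Rightarrow> 'v pair_pre_digraph \<Rightarrow> ('v \<Rightarrow> nat) \<Rightarrow> ('v \<Rightarrow> nat) \<Rightarrow> 'v set \<Rightarrow> bool" where
  "is_GDS k G \<tau> C S \<longleftrightarrow>
     proper_coloring G k C \<and> S \<subseteq> pverts G \<and>
     (\<forall>v \<in> pverts G. first_fit G \<tau> ((Some \<circ> C) |` S) v = Some (C v))"

end

theory Submission
  imports Defs
begin

text \<open>
  By induction along the scan, every colored vertex carries its \<open>C\<close>-color. When an unfixed vertex
  \<open>v\<close> is reached, properness makes \<open>C v\<close> available. A smaller color \<open>x\<close> missing from the colored
  neighbors of \<open>v\<close> would mean that all neighbors of \<open>C\<close>-color \<open>x\<close> are unfixed and come later than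
  \<open>v\<close>, so \<open>v\<close> together with them would be a descent that avoids \<open>S\<close>.
\<close>

text \<open>\<open>T\<close> plays the set of vertices colored so far. Properness keeps
  \<open>C v\<close> available, and \<open>blocked\<close> rules out every smaller positive
  color.\<close>

lemma first_fit_step_restrict_map:
  assumes "proper_coloring G k C" and "v \<in> pverts G"
    and blocked: "\<And>x. 1 \<le> x \<Longrightarrow> x < C v \<Longrightarrow> color_nbrs G C v x \<inter> T \<noteq> {}"
  shows "first_fit_step G v ((Some \<circ> C) |` T) = (Some \<circ> C) |` insert v T"
proof -
  have "(LEAST i. i \<ge> 1 \<and> (\<forall>u \<in> pverts G. (v, u) \<in> parcs G \<longrightarrow> ((Some \<circ> C) |` T) u \<noteq> Some i)) = C v"
  proof (rule Least_equality)
    show "C v \<ge> 1 \<and> (\<forall>u \<in> pverts G. (v, u) \<in> parcs G \<longrightarrow> ((Some \<circ> C) |` T) u \<noteq> Some (C v))"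
      using assms(1,2) by (auto simp: proper_coloring_def restrict_map_def split: if_splits)
  next
    fix i
    assume i: "i \<ge> 1 \<and> (\<forall>u \<in> pverts G. (v, u) \<in> parcs G \<longrightarrow> ((Some \<circ> C) |` T) u \<noteq> Some i)"
    then have "color_nbrs G C v i \<inter> T = {}"
      by (auto simp: color_nbrs_def)
    with blocked i show "C v \<le> i"
      by (meson not_le)
  qed
  then show ?thesis
    by (auto simp: first_fit_step_def restrict_map_def fun_eq_iff)
qed

text \<open>Quantifying over all splits of \<open>vs\<close>, with \<open>us\<close> the vertices
  scanned before \<open>v\<close>, makes the hypothesis pass to prefixes, as induction from the
  right requires.\<close>

lemma fold_first_fit_step_restrict_map:
  assumes "proper_coloring G k C" and "set vs \<subseteq> pverts G"
    and "\<And>us v ws x. vs = us @ v # ws \<Longrightarrow> 1 \<le> x \<Longrightarrow> x < C v \<Longrightarrow>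
      color_nbrs G C v x \<inter> (T \<union> set us) \<noteq> {}"
  shows "fold (first_fit_step G) vs ((Some \<circ> C) |` T) = (Some \<circ> C) |` (T \<union> set vs)"
  using assms(2,3)
proof (induction vs rule: rev_induct)
  case Nil
  then show ?case by simp
next
  case (snoc v vs)
  have "fold (first_fit_step G) vs ((Some \<circ> C) |` T) = (Some \<circ> C) |` (T \<union> set vs)"
    using snoc.prems by (intro snoc.IH) auto
  moreover have "first_fit_step G v ((Some \<circ> C) |` (T \<union> set vs)) =
      (Some \<circ> C) |` insert v (T \<union> set vs)"
    \<comment> \<open>With an empty tail, the vertices scanned before \<open>v\<close> are exactly
      those of \<open>vs\<close>.\<close>
    using snoc.prems(1) snoc.prems(2)[of vs v "[]"]
    by (intro first_fit_step_restrict_map[OF assms(1)]) auto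
  ultimately show ?case by (simp add: comp_def)
qed

text \<open>
  Stated in the class context because interpreting \<open>folding_insort_key\<close> elsewhere yields facts
  about the locale version of \<open>sorted_key_list_of_set\<close>, not the overloaded constant.
\<close>

lemma (in linorder) sorted_key_list_of_set_if_inj_on:
  assumes "inj_on f A" and "finite A"
  shows "set (sorted_key_list_of_set f A) = A"
    and "sorted_wrt (<) (map f (sorted_key_list_of_set f A))"
proof -
  interpret folding_insort_key "(\<le>)" "(<)" A f
    by unfold_locales (rule assms(1))
  show "set (sorted_key_list_of_set f A) = A"
    and "sorted_wrt (<) (map f (sorted_key_list_of_set f A))"
    using assms(2) by simp_all
qed

text \<open>Injectivity of \<open>\<tau>\<close> makes the scan strictly increasing, matching the
  strict inequality in a descent.\<close>

lemma is_GDS_if_meets_descents: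
  assumes fin: "finite (pverts G)" and inj: "inj_on \<tau> (pverts G)"
    and proper: "proper_coloring G k C" and S: "S \<subseteq> pverts G"
    and meets: "\<And>D. is_descent G k C \<tau> D \<Longrightarrow> S \<inter> D \<noteq> {}"
  shows "is_GDS k G \<tau> C S"
proof -
  define vs where "vs = sorted_key_list_of_set \<tau> (pverts G - S)"
  have "inj_on \<tau> (pverts G - S)" and "finite (pverts G - S)"
    using inj fin by (auto intro: inj_on_subset)
  then have set_vs: "set vs = pverts G - S" and sorted: "sorted_wrt (<) (map \<tau> vs)"
    by (simp_all add: vs_def sorted_key_list_of_set_if_inj_on)
  have "color_nbrs G C v x \<inter> (S \<union> set us) \<noteq> {}"
    if split: "vs = us @ v # ws" and x: "1 \<le> x" "x < C v" for us v ws x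
  proof
    assume free: "color_nbrs G C v x \<inter> (S \<union> set us) = {}"
    have v: "v \<in> pverts G" "v \<notin> S"
      using split set_vs by auto
    have "\<tau> u > \<tau> v" if u: "u \<in> color_nbrs G C v x" for u
    proof -
      \<comment> \<open>\<open>free\<close> keeps \<open>u\<close> out of \<open>S\<close> and
        \<open>us\<close>; \<open>u \<noteq> v\<close> because \<open>C u = x < C v\<close>.\<close>
      have "u \<in> set vs" "u \<notin> set us" "u \<noteq> v"
        using u free set_vs x by (auto simp: color_nbrs_def)
      then have "u \<in> set ws"
        using split by simp
      then show ?thesis
        using sorted split by (simp add: sorted_wrt_append)
    qed
    moreover have "C v \<le> k"
      using proper v by (auto simp: proper_coloring_def)
    ultimately have "is_descent G k C \<tau> ({v} \<union> color_nbrs G C v x)"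
      unfolding is_descent_def using v x by blast
    then show False
      using meets free v by blast
  qed
  then have "fold (first_fit_step G) vs ((Some \<circ> C) |` S) = (Some \<circ> C) |` (S \<union> set vs)"
    using set_vs by (intro fold_first_fit_step_restrict_map[OF proper]) auto
  \<comment> \<open>\<open>first_fit\<close> reads the fixed vertices off the domain of the
    pre-coloring, so this identifies its scan list with \<open>vs\<close>.\<close>
  moreover have "dom ((Some \<circ> C) |` S) = S"
    by (auto simp: dom_def restrict_map_def)
  ultimately have "first_fit G \<tau> ((Some \<circ> C) |` S) = (Some \<circ> C) |` pverts G"
    using S set_vs by (simp add: first_fit_def vs_def Un_absorb1)
  then show ?thesis
    using proper S by (simp add: is_GDS_def)
qed

theorem theorem6:
  fixes G :: "'a pair_pre_digraph" and H :: "'b pair_pre_digraph"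
    and \<tau> :: "'a \<times> 'b \<Rightarrow> nat" and C :: "'a \<times> 'b \<Rightarrow> nat"
    and k :: nat and S :: "('a \<times> 'b) set"
  assumes "pair_graph G" and "pair_graph H"
    and "vertex_ordering (G \<box> H) \<tau>"
    and "proper_coloring (G \<box> H) k C"
    and "S \<subseteq> pverts (G \<box> H)"
    and "\<And>D. is_descent (G \<box> H) k C \<tau> D \<Longrightarrow> S \<inter> D \<noteq> {}"
  shows "is_GDS k (G \<box> H) \<tau> C S"
proof (rule is_GDS_if_meets_descents[OF _ _ assms(4-6)])
  interpret pair_graph "G \<box> H"
    using assms(1,2) by (rule pair_graph_cart_prod)
  show "finite (pverts (G \<box> H))"
    by simp
  show "inj_on \<tau> (pverts (G \<box> H))"
    using assms(3) by (simp add: vertex_ordering_def bij_betw_def)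
qed

end
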